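(* Let $(Q,*,\le)$ be an ordered quandle. Let $\Gamma$ be the complete graph with vertex set $Q$; for $x\in Q$ define $\varphi_x:Q\to Q$ by $\varphi_x(y)=y$ if $x\le y$ and $\varphi_x(y)=y*x$ if $y\le x$; and set $\mu(x)=\infty$ for all $x\in Q$. Then $(\Gamma, \le, \mu, (\varphi_x)_{x\in Q})$ is a trickle graph.
   Context: **Quandles.** A quandle is a non-empty set $Q$ with a binary operation $*$ such that: (1) $x*x=x$ for all $x$; (2) $(z*x)*(y*x)=(z*y)*x$ for all $x,y,z$; (3) for all $x$ the map $Q\to Q$, $y\mapsto y*x$, is a bijection. An ordered quandle is a quandle $Q$ with a total order $\le$ such that for all $x,y,z\in Q$, $y\le z$ iff $y*x\le z*x$. **Trickle graphs.** For a simplicial graph $\Gamma$ (no loops or multiple edges, possibly infinite) with vertex set $V(\Gamma)$ and edge set $E(\Gamma)$, $\mathrm{star}_x(\Gamma)$ is the full subgraph spanned by $x$ and all vertices adjacent to $x$. A trickle graph is a quadruple $(\Gamma,\le,\mu,(\varphi_x)_{x\in V(\Gamma)})$ where $\Gamma$ is a simplicial graph, $\le$ is a partial order on $V(\Gamma)$, $\mu:V(\Gamma)\to\mathbb N_{\ge 2}\cup\{\infty\}$ is a labeling, and each $\varphi_x$ is a graph automorphism of $\mathrm{star}_x(\Gamma)$, such that, writing $x||y$ if $x\not\le y$ and $y\not\le x$, and $E_{||}(\Gamma)=\{\{x,y\}\in E(\Gamma)\mid x||y\}$: (a) if $x<y$ then $\{x,y\}\in E(\Gamma)$; (b) if $\{x,y\}\in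 E_{||}(\Gamma)$ and $z\le y$, then $\{x,z\}\in E_{||}(\Gamma)$; (c) for all $x$ and all $y,z\in \mathrm{star}_x(\Gamma)$: $z\le y$ iff $\varphi_x(z)\le\varphi_x(y)$; (d) for all $x$ and $y\in\mathrm{star}_x(\Gamma)$: if $\varphi_x(y)\ne y$ then $y<x$; (e) if $\mu(x)$ is finite, then $\varphi_x$ has finite order dividing $\mu(x)$; (f) $\mu(\varphi_x(y))=\mu(y)$ for all $x$ and $y\in \mathrm{star}_x(\Gamma)$; (g) if $z<y<x$ then $(\varphi_x\circ\varphi_y)(z)=(\varphi_{y'}\circ\varphi_x)(z)$ where $y'=\varphi_x(y)$. *)

theory Defs
  imports
    "HOL-Library.Extended_Nat"
    "HOL-Library.Ramsey"
    "HOL-Algebra.Bij"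
    "HOL-Algebra.Multiplicative_Group"
begin

locale quandle =
  fixes Q :: "'a set" and qop :: "'a \<Rightarrow> 'a \<Rightarrow> 'a" (infixl \<open>\<star>\<close> 70)
  assumes nonempty: "Q \<noteq> {}"
    and closed: "\<lbrakk>x \<in> Q; y \<in> Q\<rbrakk> \<Longrightarrow> x \<star> y \<in> Q"
    and idem: "x \<in> Q \<Longrightarrow> x \<star> x = x"
    and distrib: "\<lbrakk>x \<in> Q; y \<in> Q; z \<in> Q\<rbrakk> \<Longrightarrow> (z \<star> x) \<star> (y \<star> x) = (z \<star> y) \<star> x"
    and bij: "x \<in> Q \<Longrightarrow> bij_betw (\<lambda>y. y \<star> x) Q Q"

text \<open>Orders are relations: \<open>(x, y) \<in> r\<close> means \<open>x \<le> y\<close>.\<close>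

locale ordered_quandle = quandle +
  fixes r :: "'a rel"
  assumes linear: "linear_order_on Q r"
    and order_iff: "\<lbrakk>x \<in> Q; y \<in> Q; z \<in> Q\<rbrakk> \<Longrightarrow> (y, z) \<in> r \<longleftrightarrow> (y \<star> x, z \<star> x) \<in> r"
begin

text \<open>
  The clauses \<open>\<phi>\<^sub>x(y) = y\<close> for \<open>x \<le> y\<close> and \<open>\<phi>\<^sub>x(y) = y \<star> x\<close> for \<open>y \<le> x\<close> agree where they
  overlap and cover all cases, so an if-expression on \<open>x \<le> y\<close> satisfies both.
\<close>

lemma if_le_clauses:
  assumes "x \<in> Q" "y \<in> Q"
  shows "(x, y) \<in> r \<Longrightarrow> (if (x, y) \<in> r then y else y \<star> x) = y"
    and "(y, x) \<in> r \<Longrightarrow> (if (x, y) \<in> r then y else y \<star> x) = y \<star> x"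
    and "(x, y) \<in> r \<or> (y, x) \<in> r"
proof -
  show "(x, y) \<in> r \<or> (y, x) \<in> r"
    using assms linear by (cases "x = y") (auto simp: order_on_defs total_on_def refl_on_def)
  show "(y, x) \<in> r \<Longrightarrow> (if (x, y) \<in> r then y else y \<star> x) = y \<star> x"
    using assms linear idem by (auto simp: order_on_defs dest: antisymD)
qed simp

end

text \<open>
  A simplicial graph is given by a vertex set \<open>V\<close>, possibly infinite, and a set \<open>E\<close> of
  two-element subsets of \<open>V\<close>.
\<close>

definition simplicial_graph :: "'a set \<Rightarrow> 'a set set \<Rightarrow> bool" where
  "simplicial_graph V E \<longleftrightarrow> E \<subseteq> [V]\<^bsup>2\<^esup>"

definition star_verts :: "'a set \<Rightarrow> 'a set set \<Rightarrow> 'a \<Rightarrow> 'a set" where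
  "star_verts V E x = {y \<in> V. y = x \<or> {x, y} \<in> E}"

definition star_edges :: "'a set \<Rightarrow> 'a set set \<Rightarrow> 'a \<Rightarrow> 'a set set" where
  "star_edges V E x = {e \<in> E. e \<subseteq> star_verts V E x}"

text \<open>
  As in \<^const>\<open>Bij\<close>, automorphisms of a graph are extensional functions on its vertex set,
  so they form a subset of the carrier of \<^term>\<open>BijGroup V\<close>.
\<close>

definition graph_auts :: "'a set \<Rightarrow> 'a set set \<Rightarrow> ('a \<Rightarrow> 'a) set" where
  "graph_auts V E =
     {f \<in> Bij V. \<forall>x\<in>V. \<forall>y\<in>V. {x, y} \<in> E \<longleftrightarrow> {f x, f y} \<in> E}"

definition incomp :: "'a rel \<Rightarrow> 'a \<Rightarrow> 'a \<Rightarrow> bool" where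
  "incomp r x y \<longleftrightarrow> (x, y) \<notin> r \<and> (y, x) \<notin> r"

definition incomp_edges :: "'a set set \<Rightarrow> 'a rel \<Rightarrow> 'a set set" where
  "incomp_edges E r = {{x, y} | x y. {x, y} \<in> E \<and> incomp r x y}"

definition strictly :: "'a rel \<Rightarrow> 'a \<Rightarrow> 'a \<Rightarrow> bool" where
  "strictly r x y \<longleftrightarrow> (x, y) \<in> r \<and> x \<noteq> y"

text \<open>
  In \<open>finite_order\<close>, the order is taken in the group of all permutations of the vertices of
  the star; \<^const>\<open>group.ord\<close> returns \<open>0\<close> for elements of infinite order.
\<close>

locale trickle_graph =
  fixes V :: "'a set" and E :: "'a set set" and r :: "'a rel"
    and \<mu> :: "'a \<Rightarrow> enat" and \<phi> :: "'a \<Rightarrow> 'a \<Rightarrow> 'a"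
  assumes graph: "simplicial_graph V E"
    and partial_order: "partial_order_on V r"
    and label: "x \<in> V \<Longrightarrow> 2 \<le> \<mu> x"
    and aut: "x \<in> V \<Longrightarrow> \<phi> x \<in> graph_auts (star_verts V E x) (star_edges V E x)"
    and less_edge: "\<lbrakk>x \<in> V; y \<in> V; strictly r x y\<rbrakk> \<Longrightarrow> {x, y} \<in> E"
    and incomp_down:
      "\<lbrakk>x \<in> V; y \<in> V; z \<in> V; {x, y} \<in> incomp_edges E r; (z, y) \<in> r\<rbrakk>
        \<Longrightarrow> {x, z} \<in> incomp_edges E r"
    and order_iff:
      "\<lbrakk>x \<in> V; y \<in> star_verts V E x; z \<in> star_verts V E x\<rbrakk>
        \<Longrightarrow> (z, y) \<in> r \<longleftrightarrow> (\<phi> x z, \<phi> x y) \<in> r"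
    and moved_less: "\<lbrakk>x \<in> V; y \<in> star_verts V E x; \<phi> x y \<noteq> y\<rbrakk> \<Longrightarrow> strictly r y x"
    and finite_order:
      "\<lbrakk>x \<in> V; \<mu> x = enat m\<rbrakk>
        \<Longrightarrow> group.ord (BijGroup (star_verts V E x)) (\<phi> x) \<noteq> 0 \<and>
            group.ord (BijGroup (star_verts V E x)) (\<phi> x) dvd m"
    and label_inv: "\<lbrakk>x \<in> V; y \<in> star_verts V E x\<rbrakk> \<Longrightarrow> \<mu> (\<phi> x y) = \<mu> y"
    and compose:
      "\<lbrakk>x \<in> V; y \<in> V; z \<in> V; strictly r z y; strictly r y x\<rbrakk>
        \<Longrightarrow> (\<phi> x \<circ> \<phi> y) z = (\<phi> (\<phi> x y) \<circ> \<phi> x) z"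

end

theory Submission
  imports Defs
begin

text \<open>
  Since \<open>x \<star> x = x\<close>, right translation by \<open>x\<close> is an order automorphism of \<open>Q\<close> that fixes \<open>x\<close>.
  It therefore preserves both the part of \<open>Q\<close> below \<open>x\<close> and the part above \<open>x\<close>. The map
  \<open>\<phi>\<^sub>x\<close> glues the translation on the lower part to the identity on the upper part, so it is again
  an order automorphism of \<open>Q\<close> (lemmas \<open>trickle_mono_iff\<close> and \<open>trickle_bij\<close>).

  In a complete graph every star is the whole graph, so every bijection of \<open>Q\<close> is a graph
  automorphism. In a linear order no two elements are incomparable, and there is
  no finite label. The one axiom with further content is the composition rule for \<open>z < y < x\<close>: by
  monotonicity all maps in it act as translations, and it becomes the self-distributivity
  \<open>(z \<star> y) \<star> x = (z \<star> x) \<star> (y \<star> x)\<close>.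
\<close>

lemma star_verts_complete:
  assumes "x \<in> V"
  shows "star_verts V ([V]\<^bsup>2\<^esup>) x = V"
  using assms by (auto simp: star_verts_def doubleton_in_nsets_2)

lemma star_edges_complete:
  assumes "x \<in> V"
  shows "star_edges V ([V]\<^bsup>2\<^esup>) x = [V]\<^bsup>2\<^esup>"
  unfolding star_edges_def star_verts_complete[OF assms] by (auto simp: nsets_def)

lemma Bij_imp_graph_auts_complete:
  assumes "f \<in> Bij V"
  shows "f \<in> graph_auts V ([V]\<^bsup>2\<^esup>)"
  using assms
  by (auto simp: graph_auts_def Bij_def doubleton_in_nsets_2 bij_betw_def inj_on_eq_iff)

lemma incomp_edges_linear:
  assumes "linear_order_on V r"
  shows "incomp_edges ([V]\<^bsup>2\<^esup>) r = {}"
  using assms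
  by (auto simp: incomp_edges_def incomp_def order_on_defs total_on_def doubleton_in_nsets_2)

context ordered_quandle
begin

definition trickle :: "'a \<Rightarrow> 'a \<Rightarrow> 'a" where
  "trickle x = (\<lambda>y\<in>Q. if (x, y) \<in> r then y else y \<star> x)"

lemma order_antisym: "\<lbrakk>(x, y) \<in> r; (y, x) \<in> r\<rbrakk> \<Longrightarrow> x = y"
  using linear by (auto simp: order_on_defs dest: antisymD)

lemma order_trans: "\<lbrakk>(x, y) \<in> r; (y, z) \<in> r\<rbrakk> \<Longrightarrow> (x, z) \<in> r"
  using linear by (auto simp: order_on_defs dest: transD)

lemma trickle_above: "\<lbrakk>x \<in> Q; y \<in> Q; (x, y) \<in> r\<rbrakk> \<Longrightarrow> trickle x y = y"
  by (simp add: trickle_def)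

lemma trickle_below: "\<lbrakk>x \<in> Q; y \<in> Q; (y, x) \<in> r\<rbrakk> \<Longrightarrow> trickle x y = y \<star> x"
  using if_le_clauses(2)[of x y] by (simp add: trickle_def)

lemma trickle_closed: "\<lbrakk>x \<in> Q; y \<in> Q\<rbrakk> \<Longrightarrow> trickle x y \<in> Q"
  by (simp add: trickle_def closed)

text \<open>Translation by \<open>x\<close> preserves the parts below and above \<open>x\<close>, because it fixes \<open>x\<close>.\<close>

lemma translate_le_iff: "\<lbrakk>x \<in> Q; y \<in> Q\<rbrakk> \<Longrightarrow> (y \<star> x, x) \<in> r \<longleftrightarrow> (y, x) \<in> r"
  using order_iff[of x y x] by (simp add: idem)

lemma le_translate_iff: "\<lbrakk>x \<in> Q; y \<in> Q\<rbrakk> \<Longrightarrow> (x, y \<star> x) \<in> r \<longleftrightarrow> (x, y) \<in> r"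
  using order_iff[of x x y] by (simp add: idem)

text \<open>
  On either side of \<open>x\<close> the map is the identity or a translation, and each preserves its side;
  hence a pair separated by \<open>x\<close> stays separated by \<open>x\<close>, in the same order.
\<close>

lemma trickle_mono_iff:
  assumes "x \<in> Q" "y \<in> Q" "z \<in> Q"
  shows "(z, y) \<in> r \<longleftrightarrow> (trickle x z, trickle x y) \<in> r"
proof (cases "(x, y) \<in> r"; cases "(x, z) \<in> r")
  assume "(x, y) \<in> r" "(x, z) \<in> r"
  then show ?thesis using assms by (simp add: trickle_above)
next
  assume y: "(x, y) \<in> r" and "(x, z) \<notin> r"
  then have z: "(z, x) \<in> r" using assms if_le_clauses(3) by blast
  then have "(z \<star> x, x) \<in> r" using assms by (simp add: translate_le_iff)
  then show ?thesis
    using assms y z by (auto simp: trickle_above trickle_below intro: order_trans)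
next
  assume y: "(x, y) \<notin> r" and z: "(x, z) \<in> r"
  then have y': "(y, x) \<in> r" using assms if_le_clauses(3) by blast
  have "(x, y \<star> x) \<notin> r" using assms y by (simp add: le_translate_iff)
  then have "(z, y \<star> x) \<notin> r" "(z, y) \<notin> r" using y z order_trans by blast+
  then show ?thesis using assms y' z by (simp add: trickle_above trickle_below)
next
  assume "(x, y) \<notin> r" "(x, z) \<notin> r"
  then have "(y, x) \<in> r" "(z, x) \<in> r" using assms if_le_clauses(3) by blast+
  then show ?thesis using assms order_iff by (simp add: trickle_below)
qed

lemma trickle_bij:
  assumes x: "x \<in> Q"
  shows "trickle x \<in> Bij Q"
proof -
  have "inj_on (trickle x) Q"
  proof (rule inj_onI)
    fix y z assume yz: "y \<in> Q" "z \<in> Q" and eq: "trickle x y = trickle x z"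
    have "(trickle x y, trickle x y) \<in> r"
      using if_le_clauses(3)[of "trickle x y" "trickle x y"] trickle_closed x yz by simp
    then have "(y, z) \<in> r" "(z, y) \<in> r"
      using trickle_mono_iff[OF x] yz eq by simp_all
    then show "y = z" by (rule order_antisym)
  qed
  moreover have "w \<in> trickle x ` Q" if w: "w \<in> Q" for w
  proof (cases "(x, w) \<in> r")
    case True
    then show ?thesis using trickle_above[OF x w] w by (metis imageI)
  next
    case False
    obtain y where y: "y \<in> Q" "w = y \<star> x"
      using bij[OF x] w by (auto simp: bij_betw_def)
    have "(w, x) \<in> r" using False if_le_clauses(3)[OF x w] by blast
    then have "(y, x) \<in> r" using y x by (simp add: translate_le_iff)
    then have "trickle x y = w" using trickle_below[OF x] y by simp
    then show ?thesis using y by blast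
  qed
  ultimately have "bij_betw (trickle x) Q Q"
    using trickle_closed[OF x] by (auto simp: bij_betw_def)
  then show ?thesis by (simp add: Bij_def trickle_def)
qed

lemma trickle_compose:
  assumes Q: "x \<in> Q" "y \<in> Q" "z \<in> Q" and zy: "(z, y) \<in> r" and yx: "(y, x) \<in> r"
  shows "trickle x (trickle y z) = trickle (trickle x y) (trickle x z)"
proof -
  have zx: "(z, x) \<in> r" using zy yx by (rule order_trans)
  have "(z \<star> y, y) \<in> r" using zy Q by (simp add: translate_le_iff)
  then have "(z \<star> y, x) \<in> r" using yx by (rule order_trans)
  then have "trickle x (trickle y z) = (z \<star> y) \<star> x"
    using Q zy by (simp add: trickle_below closed)
  also have "\<dots> = (z \<star> x) \<star> (y \<star> x)" using Q by (simp add: distrib)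
  also have "\<dots> = trickle (y \<star> x) (z \<star> x)"
    using Q zy order_iff[of x z y] by (simp add: trickle_below closed)
  also have "\<dots> = trickle (trickle x y) (trickle x z)"
    using Q yx zx by (simp add: trickle_below)
  finally show ?thesis .
qed

theorem trickle_graph_complete: "trickle_graph Q ([Q]\<^bsup>2\<^esup>) r (\<lambda>x. \<infinity>) trickle"
proof
  show "simplicial_graph Q ([Q]\<^bsup>2\<^esup>)" by (simp add: simplicial_graph_def)
  show "partial_order_on Q r" using linear by (simp add: linear_order_on_def)
  show "trickle x \<in> graph_auts (star_verts Q ([Q]\<^bsup>2\<^esup>) x) (star_edges Q ([Q]\<^bsup>2\<^esup>) x)"
    if "x \<in> Q" for x
    using that
    by (simp add: star_verts_complete star_edges_complete Bij_imp_graph_auts_complete trickle_bij)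
  show "{x, y} \<in> [Q]\<^bsup>2\<^esup>" if "x \<in> Q" "y \<in> Q" "strictly r x y" for x y
    using that by (simp add: strictly_def doubleton_in_nsets_2)
  show "{x, z} \<in> incomp_edges ([Q]\<^bsup>2\<^esup>) r" if "{x, y} \<in> incomp_edges ([Q]\<^bsup>2\<^esup>) r" for x y z
    using that by (simp add: incomp_edges_linear[OF linear])
  show "(z, y) \<in> r \<longleftrightarrow> (trickle x z, trickle x y) \<in> r"
    if "x \<in> Q" "y \<in> star_verts Q ([Q]\<^bsup>2\<^esup>) x" "z \<in> star_verts Q ([Q]\<^bsup>2\<^esup>) x" for x y z
    using that by (simp add: star_verts_complete trickle_mono_iff[symmetric])
  show "strictly r y x"
    if "x \<in> Q" "y \<in> star_verts Q ([Q]\<^bsup>2\<^esup>) x" "trickle x y \<noteq> y" for x y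
  proof -
    have y: "y \<in> Q" using that by (simp add: star_verts_complete)
    have "(x, y) \<notin> r" using that y trickle_above by blast
    then show ?thesis using that(1) y if_le_clauses(3)[of x y] by (auto simp: strictly_def)
  qed
  show "(trickle x \<circ> trickle y) z = (trickle (trickle x y) \<circ> trickle x) z"
    if "x \<in> Q" "y \<in> Q" "z \<in> Q" "strictly r z y" "strictly r y x" for x y z
    using that by (simp add: strictly_def trickle_compose)
qed simp_all

end

theorem proposition3p17:
  fixes Q :: "'a set" and qop :: "'a \<Rightarrow> 'a \<Rightarrow> 'a" and r :: "'a rel"
  assumes "ordered_quandle Q qop r"
  shows "trickle_graph Q ([Q]\<^bsup>2\<^esup>) r (\<lambda>x. \<infinity>)
           (\<lambda>x. \<lambda>y\<in>Q. if (x, y) \<in> r then y else qop y x)"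
proof -
  interpret ordered_quandle Q qop r by (rule assms)
  show ?thesis using trickle_graph_complete unfolding trickle_def .
qed

end
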